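(* Let $f$ be a real-valued function on the bounded subsets of $\mathbb{R}^d$. Then there is a convex body $K$ in $\mathbb{R}^d$ such that $f(A) = R(A,K)$ for all bounded $A \subseteq \mathbb{R}^d$ if and only if $f$ is sublinear, monotonic, and $f$ restricted to finite subsets of $\mathbb{R}^d$ is a Minkowski diversity.
   Context: A convex body in $\mathbb{R}^d$ is a compact, convex set with non-empty interior. For a convex body $K$ in $\mathbb{R}^d$ and bounded $A \subseteq \mathbb{R}^d$, the generalized circumradius of $A$ with respect to $K$ is \[R(A,K) = \inf\{\lambda \ge 0 : A \subseteq \lambda K+x \mbox{ for some } x \in \mathbb{R}^d\}.\] A diversity is a pair $(X,\delta)$ where $X$ is a set and $\delta$ is a function from the finite subsets of $X$ to $\mathbb{R}_{\geq 0}$ such that, for all finite $A,B,C \subseteq X$: (D1) $\delta(A)=0$ if and only if $|A| \leq 1$; (D2) if $B \neq \emptyset$ then $\delta(A \cup C) \leq \delta(A \cup B) + \delta(B \cup C)$. A diversity $(\mathbb{R}^d,\delta)$ (or the function $\delta$) is a Minkowski diversity if there is a convex body $K \subseteq \mathbb{R}^d$ such that $\delta(A) = R(A,K)$ for all finite $A \subset \mathbb{R}^d$. A real-valued function $f$ on bounded subsets of $\mathbb{R}^d$ is sublinear if $f(A+B) \leq f(A) + f(B)$ for all bounded $A,B$ and $f(\lambda A) = \lambda f(A)$ for all bounded $A$ and all real $\lambda \geq 0$, where $A+B$ denotes the Minkowski sum. It is monotonic if $A \subseteq B$ implies $f(A) \leq f(B)$. *)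

theory Defs
  imports "HOL-Analysis.Analysis" "HOL-Library.Set_Algebras"
begin

definition convex_body :: "('a::euclidean_space) set \<Rightarrow> bool" where
  "convex_body K \<longleftrightarrow> compact K \<and> convex K \<and> interior K \<noteq> {}"

text \<open>For bounded \<open>A\<close> and a convex body \<open>K\<close> the infimum below is over a nonempty set of
  nonnegative reals; outside this case the value is not meaningful.\<close>

definition circumradius :: "('a::euclidean_space) set \<Rightarrow> 'a set \<Rightarrow> real" where
  "circumradius A K = Inf {r. 0 \<le> r \<and> (\<exists>x. A \<subseteq> (+) x ` (*\<^sub>R) r ` K)}"

text \<open>A function on the finite subsets of \<open>X\<close> is represented by a total function on sets of which
  only the values at finite subsets of \<open>X\<close> are ever used; hence restricting a function to
  the finite sets requires no separate operation.\<close>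

definition diversity :: "'a set \<Rightarrow> ('a set \<Rightarrow> real) \<Rightarrow> bool" where
  "diversity X \<delta> \<longleftrightarrow>
     (\<forall>A. finite A \<and> A \<subseteq> X \<longrightarrow> 0 \<le> \<delta> A) \<and>
     (\<forall>A. finite A \<and> A \<subseteq> X \<longrightarrow> (\<delta> A = 0 \<longleftrightarrow> card A \<le> 1)) \<and>
     (\<forall>A B C. finite A \<and> A \<subseteq> X \<and> finite B \<and> B \<subseteq> X \<and> finite C \<and> C \<subseteq> X \<and> B \<noteq> {} \<longrightarrow>
        \<delta> (A \<union> C) \<le> \<delta> (A \<union> B) + \<delta> (B \<union> C))"

definition minkowski_diversity :: "(('a::euclidean_space) set \<Rightarrow> real) \<Rightarrow> bool" where
  "minkowski_diversity \<delta> \<longleftrightarrow>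
     diversity UNIV \<delta> \<and>
     (\<exists>K. convex_body K \<and> (\<forall>A. finite A \<longrightarrow> \<delta> A = circumradius A K))"

text \<open>Here \<open>A + B\<close> is the elementwise sum of sets, i.e. the Minkowski sum.\<close>

definition sublinear :: "(('a::euclidean_space) set \<Rightarrow> real) \<Rightarrow> bool" where
  "sublinear f \<longleftrightarrow>
     (\<forall>A B. bounded A \<and> bounded B \<longrightarrow> f (A + B) \<le> f A + f B) \<and>
     (\<forall>A r. bounded A \<and> 0 \<le> r \<longrightarrow> f ((*\<^sub>R) r ` A) = r * f A)"

definition monotonic :: "(('a::euclidean_space) set \<Rightarrow> real) \<Rightarrow> bool" where
  "monotonic f \<longleftrightarrow> mono_on {A. bounded A} f"

end

theory Submission imports Defs begin

text \<open>A bounded set \<open>A\<close> contains, for every \<open>e > 0\<close>, a finite \<open>F\<close> with \<open>F \<subseteq> A \<subseteq> F + e D\<close>, where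
  \<open>D\<close> is the unit ball. Hence two sublinear monotonic functions \<open>f\<close> and \<open>g\<close> satisfy
  \<open>f A \<le> f F + e f D\<close> and \<open>g F \<le> g A\<close>, so agreement on finite sets forces agreement on bounded
  sets. It remains to see that \<open>R(\<cdot>, K)\<close> is sublinear, monotonic and a diversity; for the triangle
  inequality (D2), a common point of \<open>r K + x\<close> and \<open>s K + y\<close> yields a translate of \<open>(r + s) K\<close>
  covering both sets.\<close>

section \<open>Finite approximation and comparison on bounded sets\<close>

lemma bounded_subset_finite_plus_cball:
  fixes A :: "'a::euclidean_space set"
  assumes "bounded A" "e > 0"
  obtains F where "finite F" "F \<subseteq> A" "A \<subseteq> F + (*\<^sub>R) e ` cball 0 1"
proof -
  have "compact (closure A)"
    using assms(1) by (simp add: compact_closure)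
  \<comment> \<open>Every point of the closure is within \<open>e\<close> of a point of
    \<open>A\<close>, so balls centred in \<open>A\<close> itself cover it; compactness then yields
    centres with \<open>F \<subseteq> A\<close>.\<close>
  moreover have "closure A \<subseteq> (\<Union>a\<in>A. ball a e)"
    using assms(2) by (force simp: closure_approachable)
  ultimately obtain F where F: "F \<subseteq> A" "finite F" "closure A \<subseteq> (\<Union>a\<in>F. ball a e)"
    using compactE_image[of "closure A" A "\<lambda>a. ball a e"] by auto
  have "A \<subseteq> F + (*\<^sub>R) e ` cball 0 1"
  proof
    fix z assume "z \<in> A"
    then obtain a where a: "a \<in> F" "dist a z < e"
      using F(3) closure_subset[of A] by fastforce
    have "z - a = e *\<^sub>R ((1 / e) *\<^sub>R (z - a))" "(1 / e) *\<^sub>R (z - a) \<in> cball 0 1"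
      using a(2) assms(2) by (auto simp: dist_norm norm_minus_commute)
    then have "z - a \<in> (*\<^sub>R) e ` cball 0 1"
      by (metis imageI)
    with a(1) show "z \<in> F + (*\<^sub>R) e ` cball 0 1"
      using set_plus_intro[of a F "z - a"] by simp
  qed
  with F that show thesis by blast
qed

text \<open>One-sided, so that the equality on bounded sets comes from two applications with the
  roles of \<open>f\<close> and \<open>g\<close> exchanged: \<open>f\<close> pays for enlarging
  \<open>F\<close> to a superset of \<open>A\<close>, while \<open>g\<close> only passes from
  \<open>F\<close> up to \<open>A\<close>.\<close>

lemma sublinear_monotonic_le:
  fixes f g :: "'a::euclidean_space set \<Rightarrow> real"
  assumes f: "sublinear f" "monotonic f" and g: "monotonic g"
    and fin: "\<And>F. finite F \<Longrightarrow> f F \<le> g F"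
    and A: "bounded A"
  shows "f A \<le> g A"
proof (rule field_le_epsilon)
  fix e :: real assume "e > 0"
  let ?D = "cball (0::'a) 1"
  \<comment> \<open>The absolute value and the \<open>+ 1\<close> make the denominator positive,
    whatever the sign of \<open>f ?D\<close>, and still give
    \<open>d * f ?D \<le> e\<close>.\<close>
  define d where "d = e / (\<bar>f ?D\<bar> + 1)"
  have d: "d > 0" "d * f ?D \<le> e"
  proof -
    show "d > 0" using \<open>e > 0\<close> by (simp add: d_def)
    then have "d * f ?D \<le> d * (\<bar>f ?D\<bar> + 1)"
      by (intro mult_left_mono) auto
    also have "\<dots> = e" by (simp add: d_def add_nonneg_eq_0_iff)
    finally show "d * f ?D \<le> e" .
  qed
  obtain F where F: "finite F" "F \<subseteq> A" "A \<subseteq> F + (*\<^sub>R) d ` ?D"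
    using bounded_subset_finite_plus_cball[OF A d(1)] by blast
  have bF: "bounded F" and bD: "bounded ((*\<^sub>R) d ` ?D)"
    using F(1) by (auto simp: finite_imp_bounded bounded_scaling)
  have "bounded (F + (*\<^sub>R) d ` ?D)"
    using bounded_plus[OF bF bD] by (simp add: set_plus_image case_prod_beta)
  then have "f A \<le> f (F + (*\<^sub>R) d ` ?D)"
    using f(2) F(3) A by (auto simp: monotonic_def mono_on_def)
  also have "\<dots> \<le> f F + f ((*\<^sub>R) d ` ?D)"
    using f(1) bF bD by (simp add: sublinear_def)
  also have "f ((*\<^sub>R) d ` ?D) = d * f ?D"
    using f(1) d(1) by (simp add: sublinear_def)
  also have "f F + d * f ?D \<le> g A + e"
  proof -
    have "g F \<le> g A"
      using g F(2) A bF by (auto simp: monotonic_def mono_on_def)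
    then show ?thesis using fin[OF F(1)] d(2) by linarith
  qed
  finally show "f A \<le> g A + e" .
qed

section \<open>Homothets of a convex body and the infimum over them\<close>

lemma convex_body_contains_cball:
  assumes "convex_body K"
  obtains c e where "e > 0" "cball c e \<subseteq> K"
proof -
  obtain c where "c \<in> interior K"
    using assms by (auto simp: convex_body_def)
  with that show thesis
    by (auto simp: mem_interior_cball)
qed

lemma convex_body_nonempty: "convex_body K \<Longrightarrow> K \<noteq> {}"
  by (auto simp: convex_body_def)

lemma convex_body_bounded: "convex_body K \<Longrightarrow> bounded K"
  by (simp add: convex_body_def compact_imp_bounded)

lemma subset_homothet_iff:
  "A \<subseteq> (+) x ` (*\<^sub>R) r ` K \<longleftrightarrow> (\<forall>a\<in>A. \<exists>k\<in>K. a = x + r *\<^sub>R k)"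
  by (auto simp: image_iff subset_iff)

text \<open>This makes the set under the infimum nonempty: a ball inside \<open>K\<close>, suitably
  enlarged and translated, swallows \<open>A\<close>.\<close>

lemma bounded_subset_homothet:
  assumes "convex_body K" "bounded A"
  obtains r x where "r \<ge> 0" "A \<subseteq> (+) x ` (*\<^sub>R) r ` K"
proof -
  obtain c e where ce: "e > 0" "cball c e \<subseteq> K"
    using convex_body_contains_cball assms(1) by blast
  obtain b where b: "b > 0" "\<And>a. a \<in> A \<Longrightarrow> norm a \<le> b"
    using assms(2) by (auto simp: bounded_pos)
  \<comment> \<open>The ratio \<open>b / e\<close> enlarges the ball of radius \<open>e\<close> in
    \<open>K\<close> to radius \<open>b\<close>, and the translation moves its centre to the
    origin.\<close>
  have "A \<subseteq> (+) (- (b / e) *\<^sub>R c) ` (*\<^sub>R) (b / e) ` K"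
    unfolding subset_homothet_iff
  proof
    fix a assume a: "a \<in> A"
    have "norm ((e / b) *\<^sub>R a) \<le> e"
      using b(1) b(2)[OF a] ce(1) by (simp add: field_simps)
    then have "c + (e / b) *\<^sub>R a \<in> K"
      using ce(2) by (auto simp: dist_norm)
    moreover have "a = - (b / e) *\<^sub>R c + (b / e) *\<^sub>R (c + (e / b) *\<^sub>R a)"
      using b(1) ce(1) by (simp add: scaleR_add_right)
    ultimately show "\<exists>k\<in>K. a = - (b / e) *\<^sub>R c + (b / e) *\<^sub>R k" by blast
  qed
  moreover have "b / e \<ge> 0" using b(1) ce(1) by simp
  ultimately show thesis using that by blast
qed

lemma circumradius_le:
  assumes "r \<ge> 0" "A \<subseteq> (+) x ` (*\<^sub>R) r ` K"
  shows "circumradius A K \<le> r"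
  unfolding circumradius_def
proof (rule cInf_lower)
  show "r \<in> {r. 0 \<le> r \<and> (\<exists>x. A \<subseteq> (+) x ` (*\<^sub>R) r ` K)}"
    using assms by blast
  show "bdd_below {r. 0 \<le> r \<and> (\<exists>x. A \<subseteq> (+) x ` (*\<^sub>R) r ` K)}"
    by (rule bdd_belowI[of _ 0]) simp
qed

text \<open>Stands in for attainment of the infimum: the inequalities that use it are proved up to
  an arbitrary \<open>e\<close> and closed by \<open>field_le_epsilon\<close>.\<close>

lemma circumradius_approx:
  assumes "convex_body K" "bounded A" "e > 0"
  obtains r x where "r \<ge> 0" "r < circumradius A K + e" "A \<subseteq> (+) x ` (*\<^sub>R) r ` K"
proof -
  let ?S = "{r. 0 \<le> r \<and> (\<exists>x. A \<subseteq> (+) x ` (*\<^sub>R) r ` K)}"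
  have "?S \<noteq> {}"
    by (rule bounded_subset_homothet[OF assms(1,2)]) auto
  then obtain r where "r \<in> ?S" "r < Inf ?S + e"
    using cInf_lessD[of ?S "Inf ?S + e"] assms(3) by auto
  then show thesis using that by (auto simp: circumradius_def)
qed

lemma circumradius_nonneg:
  assumes "convex_body K" "bounded A"
  shows "0 \<le> circumradius A K"
  unfolding circumradius_def
proof (rule cInf_greatest)
  show "{r. 0 \<le> r \<and> (\<exists>x. A \<subseteq> (+) x ` (*\<^sub>R) r ` K)} \<noteq> {}"
    by (rule bounded_subset_homothet[OF assms]) auto
qed auto

lemma circumradius_mono:
  assumes "convex_body K" "bounded B" "A \<subseteq> B"
  shows "circumradius A K \<le> circumradius B K"
proof (rule field_le_epsilon)
  fix e :: real assume "e > 0"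
  then obtain r x where "r \<ge> 0" "r < circumradius B K + e" "B \<subseteq> (+) x ` (*\<^sub>R) r ` K"
    using circumradius_approx[OF assms(1,2)] by blast
  then show "circumradius A K \<le> circumradius B K + e"
    using circumradius_le[of r A x K] assms(3) by force
qed

section \<open>Subadditivity and the triangle inequality\<close>

text \<open>Isolates the epsilon argument common to Minkowski sums and (D2), leaving only a
  geometric covering statement to each.\<close>

lemma circumradius_le_add:
  assumes "convex_body K" "bounded A" "bounded B"
    and "\<And>r s x y. \<lbrakk>r \<ge> 0; s \<ge> 0; A \<subseteq> (+) x ` (*\<^sub>R) r ` K; B \<subseteq> (+) y ` (*\<^sub>R) s ` K\<rbrakk>
           \<Longrightarrow> \<exists>z. C \<subseteq> (+) z ` (*\<^sub>R) (r + s) ` K"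
  shows "circumradius C K \<le> circumradius A K + circumradius B K"
proof (rule field_le_epsilon)
  fix e :: real assume "e > 0"
  then have "e / 2 > 0" by simp
  obtain r x where r: "r \<ge> 0" "r < circumradius A K + e / 2" "A \<subseteq> (+) x ` (*\<^sub>R) r ` K"
    using circumradius_approx[OF assms(1,2) \<open>e / 2 > 0\<close>] by blast
  obtain s y where s: "s \<ge> 0" "s < circumradius B K + e / 2" "B \<subseteq> (+) y ` (*\<^sub>R) s ` K"
    using circumradius_approx[OF assms(1,3) \<open>e / 2 > 0\<close>] by blast
  obtain z where "C \<subseteq> (+) z ` (*\<^sub>R) (r + s) ` K"
    using assms(4)[OF r(1) s(1) r(3) s(3)] by blast
  then have "circumradius C K \<le> r + s"
    using r(1) s(1) by (intro circumradius_le) auto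
  then show "circumradius C K \<le> circumradius A K + circumradius B K + e"
    using r(2) s(2) by linarith
qed

text \<open>The inclusion \<open>r K + s K \<subseteq> (r + s) K\<close>, the point where convexity
  enters: normalising the weights by \<open>r + s\<close> gives a convex combination.\<close>

lemma convex_scaleR_add_obtain:
  assumes "convex K" "k \<in> K" "l \<in> K" "r \<ge> 0" "s \<ge> 0"
  obtains m where "m \<in> K" "(r + s) *\<^sub>R m = r *\<^sub>R k + s *\<^sub>R l"
proof -
  have "r *\<^sub>R k + s *\<^sub>R l \<in> (\<lambda>x. (r + s) *\<^sub>R x) ` K"
  proof (cases "r + s = 0")
    \<comment> \<open>The weights cannot be normalised here, but both sides vanish and any point of
      \<open>K\<close> serves.\<close>
    case True
    then have "r = 0" "s = 0" using assms(4,5) by auto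
    then show ?thesis using assms(2) by (auto intro!: image_eqI[of _ _ k])
  next
    case False
    have "(r / (r + s)) *\<^sub>R k + (s / (r + s)) *\<^sub>R l \<in> K"
      using assms False by (intro convexD) (auto simp: add_divide_distrib[symmetric])
    then show ?thesis
      using False by (intro image_eqI[of _ _ "(r / (r + s)) *\<^sub>R k + (s / (r + s)) *\<^sub>R l"])
        (auto simp: scaleR_add_right)
  qed
  then show thesis using that by force
qed

lemma circumradius_plus_le:
  assumes "convex_body K" "bounded A" "bounded B"
  shows "circumradius (A + B) K \<le> circumradius A K + circumradius B K"
proof (rule circumradius_le_add[OF assms])
  fix r s x y
  assume r: "r \<ge> 0" "A \<subseteq> (+) x ` (*\<^sub>R) r ` K" and s: "s \<ge> 0" "B \<subseteq> (+) y ` (*\<^sub>R) s ` K"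
  have "A + B \<subseteq> (+) (x + y) ` (*\<^sub>R) (r + s) ` K"
    unfolding subset_homothet_iff
  proof
    fix z assume "z \<in> A + B"
    then obtain a b where "a \<in> A" "b \<in> B" and z: "z = a + b"
      by (auto elim: set_plus_elim)
    then obtain k l where "k \<in> K" "l \<in> K" "a = x + r *\<^sub>R k" "b = y + s *\<^sub>R l"
      using r(2) s(2) unfolding subset_homothet_iff by metis
    then obtain m where "m \<in> K" "(r + s) *\<^sub>R m = r *\<^sub>R k + s *\<^sub>R l"
      using convex_scaleR_add_obtain assms(1) r(1) s(1) unfolding convex_body_def by metis
    then show "\<exists>m\<in>K. z = x + y + (r + s) *\<^sub>R m"
      using z \<open>a = _\<close> \<open>b = _\<close> by (intro bexI[of _ m]) (auto simp: algebra_simps)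
  qed
  then show "\<exists>z. A + B \<subseteq> (+) z ` (*\<^sub>R) (r + s) ` K" ..
qed

lemma circumradius_triangle:
  assumes "convex_body K" "bounded A" "bounded B" "bounded C" "B \<noteq> {}"
  shows "circumradius (A \<union> C) K \<le> circumradius (A \<union> B) K + circumradius (B \<union> C) K"
proof (rule circumradius_le_add)
  fix r s x y
  assume r: "r \<ge> 0" "A \<union> B \<subseteq> (+) x ` (*\<^sub>R) r ` K" and s: "s \<ge> 0" "B \<union> C \<subseteq> (+) y ` (*\<^sub>R) s ` K"
  from assms(5) obtain b where "b \<in> B" by blast
  then obtain k l where kl: "k \<in> K" "l \<in> K" and b: "b = x + r *\<^sub>R k" "b = y + s *\<^sub>R l"
    using r(2) s(2) unfolding subset_homothet_iff by (meson UnI1 UnI2)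
  have sum: "\<exists>m\<in>K. (r + s) *\<^sub>R m = r *\<^sub>R p + s *\<^sub>R q" if "p \<in> K" "q \<in> K" for p q
    using convex_scaleR_add_obtain assms(1) r(1) s(1) that unfolding convex_body_def by metis
  \<comment> \<open>By the two expressions for \<open>b\<close>, the centre
    \<open>x - s *\<^sub>R l\<close> equals \<open>y - r *\<^sub>R k\<close>. Hence a point
    \<open>x + r *\<^sub>R p\<close> of \<open>A\<close> is reached by pairing \<open>p\<close> with
    \<open>l\<close>, and a point \<open>y + s *\<^sub>R q\<close> of \<open>C\<close> by pairing
    \<open>k\<close> with \<open>q\<close>.\<close>
  have "A \<union> C \<subseteq> (+) (x - s *\<^sub>R l) ` (*\<^sub>R) (r + s) ` K"
    unfolding subset_homothet_iff
  proof
    fix z assume "z \<in> A \<union> C"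
    then consider "z \<in> A" | "z \<in> C" by blast
    then show "\<exists>m\<in>K. z = x - s *\<^sub>R l + (r + s) *\<^sub>R m"
    proof cases
      case 1
      then obtain p where "p \<in> K" "z = x + r *\<^sub>R p"
        using r(2) unfolding subset_homothet_iff by blast
      then show ?thesis using sum[of p l] kl by force
    next
      case 2
      then obtain q where q: "q \<in> K" "z = y + s *\<^sub>R q"
        using s(2) unfolding subset_homothet_iff by blast
      have "y = x - s *\<^sub>R l + r *\<^sub>R k"
        using b by (simp add: algebra_simps)
      then show ?thesis using sum[of k q] kl q by (force simp: add.assoc)
    qed
  qed
  then show "\<exists>z. A \<union> C \<subseteq> (+) z ` (*\<^sub>R) (r + s) ` K" ..
qed (use assms in auto)

section \<open>Homogeneity and the vanishing of the circumradius\<close>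

lemma circumradius_scaleR_le:
  assumes "convex_body K" "bounded A" "r \<ge> 0"
  shows "circumradius ((*\<^sub>R) r ` A) K \<le> r * circumradius A K"
proof (rule field_le_epsilon)
  fix e :: real assume "e > 0"
  \<comment> \<open>Dividing by \<open>r + 1\<close> stays meaningful at \<open>r = 0\<close>, and
    multiplying by \<open>r\<close> afterwards leaves an error of at most \<open>e\<close>.\<close>
  with assms(3) have e: "e / (r + 1) > 0" by simp
  obtain s x where s: "s \<ge> 0" "s < circumradius A K + e / (r + 1)" "A \<subseteq> (+) x ` (*\<^sub>R) s ` K"
    using circumradius_approx[OF assms(1,2) e] by blast
  have "(*\<^sub>R) r ` A \<subseteq> (+) (r *\<^sub>R x) ` (*\<^sub>R) (r * s) ` K"
    using s(3) unfolding subset_homothet_iff by (force simp: scaleR_add_right)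
  then have "circumradius ((*\<^sub>R) r ` A) K \<le> r * s"
    using assms(3) s(1) by (intro circumradius_le) auto
  also have "\<dots> \<le> r * (circumradius A K + e / (r + 1))"
    using s(2) assms(3) by (intro mult_left_mono) auto
  also have "\<dots> \<le> r * circumradius A K + e"
    using assms(3) \<open>e > 0\<close> by (simp add: field_simps)
  finally show "circumradius ((*\<^sub>R) r ` A) K \<le> r * circumradius A K + e" .
qed

text \<open>For \<open>r > 0\<close> the converse bound is the one-sided one applied to the dilation
  by \<open>1 / r\<close>, which undoes the first. At \<open>r = 0\<close> the value is squeezed
  between 0 and 0.\<close>

lemma circumradius_scaleR:
  assumes "convex_body K" "bounded A" "r \<ge> 0"
  shows "circumradius ((*\<^sub>R) r ` A) K = r * circumradius A K"
proof (cases "r = 0")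
  case True
  then show ?thesis
    using circumradius_scaleR_le[OF assms] circumradius_nonneg[OF assms(1) bounded_scaling[OF assms(2), of r]]
    by simp
next
  case False
  have "circumradius ((*\<^sub>R) (1 / r) ` (*\<^sub>R) r ` A) K \<le> 1 / r * circumradius ((*\<^sub>R) r ` A) K"
    using assms by (intro circumradius_scaleR_le bounded_scaling) auto
  moreover have "(*\<^sub>R) (1 / r) ` (*\<^sub>R) r ` A = A"
    using False by (simp add: image_image)
  ultimately have "r * circumradius A K \<le> circumradius ((*\<^sub>R) r ` A) K"
    using False assms(3) by (simp add: field_simps)
  then show ?thesis using circumradius_scaleR_le[OF assms] by simp
qed

text \<open>A homothet of ratio 0 is a single point. Conversely, if \<open>K\<close> lies in a ball
  of radius \<open>M\<close>, a homothet of ratio \<open>r\<close> has diameter at most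
  \<open>2 * M * r\<close>, so arbitrarily small ratios force all points of \<open>A\<close> to
  coincide.\<close>

lemma circumradius_eq_0_iff:
  assumes "convex_body K" "finite A"
  shows "circumradius A K = 0 \<longleftrightarrow> card A \<le> 1"
proof
  assume "card A \<le> 1"
  then have "\<forall>a\<in>A. \<forall>b\<in>A. a = b"
    using assms(2) by (simp add: card_le_Suc0_iff_eq)
  \<comment> \<open>Inclusion instead of equality covers the empty set as well.\<close>
  then obtain a where "A \<subseteq> {a}"
    by blast
  then have "A \<subseteq> (+) a ` (*\<^sub>R) 0 ` K"
    using convex_body_nonempty[OF assms(1)] unfolding subset_homothet_iff by auto
  then have "circumradius A K \<le> 0"
    by (intro circumradius_le) auto
  then show "circumradius A K = 0"
    using circumradius_nonneg assms finite_imp_bounded by (metis order_antisym)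
next
  assume 0: "circumradius A K = 0"
  obtain M where M: "M > 0" "\<And>k. k \<in> K \<Longrightarrow> norm k \<le> M"
    using convex_body_bounded[OF assms(1)] by (auto simp: bounded_pos)
  have "a = b" if ab: "a \<in> A" "b \<in> A" for a b
  proof -
    have "norm (a - b) \<le> 0"
    proof (rule field_le_epsilon)
      fix e :: real assume "e > 0"
      with M(1) have e: "e / (2 * M) > 0" by simp
      obtain r x where r: "r \<ge> 0" "r < e / (2 * M)" "A \<subseteq> (+) x ` (*\<^sub>R) r ` K"
        using circumradius_approx[OF assms(1) finite_imp_bounded[OF assms(2)] e]
        unfolding 0 add_0 by blast
      then obtain k l where kl: "k \<in> K" "l \<in> K" "a = x + r *\<^sub>R k" "b = x + r *\<^sub>R l"
        using ab unfolding subset_homothet_iff by metis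
      have "norm (a - b) = r * norm (k - l)"
        using kl r(1) by (simp flip: scaleR_diff_right)
      also have "\<dots> \<le> r * (2 * M)"
        using norm_triangle_ineq4[of k l] M(2)[OF kl(1)] M(2)[OF kl(2)] r(1)
        by (intro mult_left_mono) auto
      also have "\<dots> \<le> e"
        using r(2) M(1) by (simp add: field_simps)
      finally show "norm (a - b) \<le> 0 + e" by simp
    qed
    then show ?thesis by simp
  qed
  then show "card A \<le> 1"
    using assms(2) by (simp add: card_le_Suc0_iff_eq)
qed

section \<open>The characterization\<close>

lemma sublinear_circumradius: "convex_body K \<Longrightarrow> sublinear (\<lambda>A. circumradius A K)"
  by (simp add: sublinear_def circumradius_plus_le circumradius_scaleR)

lemma monotonic_circumradius: "convex_body K \<Longrightarrow> monotonic (\<lambda>A. circumradius A K)"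
  by (simp add: monotonic_def mono_on_def circumradius_mono)

lemma diversity_circumradius: "convex_body K \<Longrightarrow> diversity UNIV (\<lambda>A. circumradius A K)"
  by (simp add: diversity_def circumradius_nonneg circumradius_eq_0_iff
      circumradius_triangle finite_imp_bounded)

theorem theorem11:
  fixes f :: "(real ^ 'n) set \<Rightarrow> real"
  shows "(\<exists>K. convex_body K \<and> (\<forall>A. bounded A \<longrightarrow> f A = circumradius A K))
    \<longleftrightarrow> sublinear f \<and> monotonic f \<and> minkowski_diversity f"
proof
  assume "\<exists>K. convex_body K \<and> (\<forall>A. bounded A \<longrightarrow> f A = circumradius A K)"
  then obtain K where K: "convex_body K" and f: "\<And>A. bounded A \<Longrightarrow> f A = circumradius A K"
    by blast
  \<comment> \<open>\<open>f\<close> is known to equal the circumradius on bounded sets only, so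
    sublinearity transfers once sums of bounded sets are known to be bounded.\<close>
  have plus: "bounded (A + B)" if "bounded A" "bounded B" for A B :: "(real ^ 'n) set"
    using bounded_plus[OF that] by (simp add: set_plus_image case_prod_beta)
  have "sublinear f"
    using sublinear_circumradius[OF K] by (simp add: sublinear_def f plus bounded_scaling)
  moreover have "monotonic f"
    using monotonic_circumradius[OF K] by (simp add: monotonic_def mono_on_def f)
  moreover have "diversity UNIV f"
    using diversity_circumradius[OF K] by (simp add: diversity_def f finite_imp_bounded)
  ultimately show "sublinear f \<and> monotonic f \<and> minkowski_diversity f"
    using K f by (auto simp: minkowski_diversity_def finite_imp_bounded)
next
  assume f: "sublinear f \<and> monotonic f \<and> minkowski_diversity f"
  then obtain K where K: "convex_body K" and fin: "\<And>A. finite A \<Longrightarrow> f A = circumradius A K"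
    by (auto simp: minkowski_diversity_def)
  \<comment> \<open>The body representing \<open>f\<close> on finite sets also represents it on
    bounded sets.\<close>
  have "f A = circumradius A K" if "bounded A" for A
  proof (rule antisym)
    show "f A \<le> circumradius A K"
      using sublinear_monotonic_le[of f "\<lambda>A. circumradius A K" A]
        monotonic_circumradius[OF K] f fin that by simp
    show "circumradius A K \<le> f A"
      using sublinear_monotonic_le[of "\<lambda>A. circumradius A K" f A]
        sublinear_circumradius[OF K] monotonic_circumradius[OF K] f fin that by simp
  qed
  with K show "\<exists>K. convex_body K \<and> (\<forall>A. bounded A \<longrightarrow> f A = circumradius A K)"
    by blast
qed

end
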